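(* The codegree Turán densities of the 3-uniform tight cycles $C_{11}$, $C_{14}$ and $C_{17}$ satisfy $\gamma(C_{11})=\gamma(C_{14})=\gamma(C_{17})=1/3$.
   Context: All hypergraphs are 3-uniform. For a 3-uniform hypergraph $H$ and a pair $\{u,v\}\subseteq V(H)$ of distinct vertices, the codegree $d_H(uv)$ is the number of vertices $w\in V(H)$ with $uvw\in E(H)$, and the minimum codegree is $\delta_2(H)=\min_{\{u,v\}\subseteq V(H)} d_H(uv)$. For a 3-uniform hypergraph $F$, the codegree Turán number $\mathrm{ex}_2(n,F)$ is the maximum of $\delta_2(H)$ over all $n$-vertex 3-uniform hypergraphs $H$ containing no copy of $F$ as a subgraph, and the codegree Turán density is $\gamma(F)=\lim_{n\to\infty}\mathrm{ex}_2(n,F)/n$. For an integer $\ell\ge 5$, the tight cycle $C_\ell$ is the 3-uniform hypergraph with vertex set $\{v_1,\dots,v_\ell\}$ and edge set $\{v_{i-1}v_iv_{i+1}: i\in\{1,\dots,\ell\}\}$, indices taken modulo $\ell$. *)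

theory Defs
  imports Complex_Main
begin

record 'a hypergraph =
  verts :: "'a set"
  edges :: "'a set set"

definition is_3graph :: "'a hypergraph \<Rightarrow> bool" where
  "is_3graph H \<longleftrightarrow> finite (verts H) \<and> (\<forall>e\<in>edges H. e \<subseteq> verts H \<and> card e = 3)"

text \<open>For distinct \<open>u\<close>, \<open>v\<close>, a vertex \<open>w\<close> with \<open>{u, v, w}\<close> an edge of a 3-graph differs from
  both, since edges have exactly three elements.\<close>

definition codegree :: "'a hypergraph \<Rightarrow> 'a \<Rightarrow> 'a \<Rightarrow> nat" where
  "codegree H u v = card {w \<in> verts H. {u, v, w} \<in> edges H}"

text \<open>Meaningful for at least two vertices only; otherwise this is the unspecified
  \<open>Min {}\<close>, which does not affect the asymptotic quantities below.\<close>

definition min_codegree :: "'a hypergraph \<Rightarrow> nat" where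
  "min_codegree H = Min {codegree H u v | u v. u \<in> verts H \<and> v \<in> verts H \<and> u \<noteq> v}"

definition contains_copy :: "'a hypergraph \<Rightarrow> 'b hypergraph \<Rightarrow> bool" where
  "contains_copy H F \<longleftrightarrow>
    (\<exists>f. inj_on f (verts F) \<and> f ` verts F \<subseteq> verts H \<and> (\<forall>e\<in>edges F. f ` e \<in> edges H))"

text \<open>Every finite hypergraph is isomorphic to one with vertices in \<open>nat\<close>, so it suffices to
  let \<open>H\<close> range over those.\<close>

definition free_codegrees :: "nat \<Rightarrow> 'b hypergraph \<Rightarrow> nat set" where
  "free_codegrees n F =
    {min_codegree H | H :: nat hypergraph.
       is_3graph H \<and> card (verts H) = n \<and> \<not> contains_copy H F}"

definition ex2 :: "nat \<Rightarrow> 'b hypergraph \<Rightarrow> nat" where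
  "ex2 n F = Max (free_codegrees n F)"

definition codegree_turan_density :: "'b hypergraph \<Rightarrow> real" where
  "codegree_turan_density F = lim (\<lambda>n. real (ex2 n F) / real n)"

definition tight_cycle :: "nat \<Rightarrow> nat hypergraph" where
  "tight_cycle l =
    \<lparr>verts = {..<l}, edges = {{i, (i + 1) mod l, (i + 2) mod l} | i. i < l}\<rparr>"

text \<open>The maximum in \<^const>\<open>ex2\<close> is taken over a finite nonempty set.\<close>

lemma min_codegree_le:
  assumes "is_3graph H" and "card (verts H) \<ge> 2"
  shows "min_codegree H \<le> card (verts H)"
proof -
  have fin: "finite (verts H)"
    using assms(1) by (simp add: is_3graph_def)
  have "\<not> card (verts H) \<le> Suc 0"
    using assms(2) by simp
  then obtain u v where uv: "u \<in> verts H" "v \<in> verts H" "u \<noteq> v"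
    using card_le_Suc0_iff_eq[OF fin] by auto
  let ?S = "{codegree H u v | u v. u \<in> verts H \<and> v \<in> verts H \<and> u \<noteq> v}"
  have "?S \<subseteq> (\<lambda>(u, v). codegree H u v) ` (verts H \<times> verts H)"
    by auto
  then have "finite ?S"
    using fin by (meson finite_SigmaI finite_imageI finite_subset)
  moreover have "codegree H u v \<in> ?S"
    using uv by blast
  ultimately have "min_codegree H \<le> codegree H u v"
    unfolding min_codegree_def by (rule Min_le)
  also have "\<dots> \<le> card (verts H)"
    unfolding codegree_def by (rule card_mono[OF fin]) auto
  finally show ?thesis .
qed

lemma finite_free_codegrees:
  assumes "n \<ge> 2"
  shows "finite (free_codegrees n F)"
proof (rule finite_subset)
  show "free_codegrees n F \<subseteq> {..n}"
    using assms min_codegree_le by (fastforce simp: free_codegrees_def)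
qed simp

lemma free_codegrees_nonempty:
  assumes "edges F \<noteq> {}"
  shows "free_codegrees n F \<noteq> {}"
proof -
  let ?H = "\<lparr>verts = {..<n}, edges = {}\<rparr>"
  have "is_3graph ?H \<and> card (verts ?H) = n \<and> \<not> contains_copy ?H F"
    using assms by (auto simp: is_3graph_def contains_copy_def)
  then show ?thesis
    unfolding free_codegrees_def by blast
qed

lemma is_3graph_tight_cycle:
  assumes "l \<ge> 3"
  shows "is_3graph (tight_cycle l)"
proof -
  have "card {i, (i + 1) mod l, (i + 2) mod l} = 3" if "i < l" for i
  proof -
    have "(i + 1) mod l = (if i + 1 < l then i + 1 else i + 1 - l)"
      and "(i + 2) mod l = (if i + 2 < l then i + 2 else i + 2 - l)"
      using that assms by (auto simp: mod_if)
    then show ?thesis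
      using that assms by (auto simp: card_insert_if)
  qed
  then show ?thesis
    using assms by (auto simp: is_3graph_def tight_cycle_def)
qed

end

theory Submission
  imports Defs
begin

text \<open>
  Lower bound: in the graph of all triples with sum 1 modulo 3, a tight walk has residues of
  period 3, so a closed walk of length not divisible by 3 would be constant modulo 3, which is
  impossible.

  Upper bound: if all codegrees exceed a third, two of the three neighbourhoods belonging to the
  pairs of an edge intersect; the common vertex of these two pairs is called an apex of the edge.
  If there is no closed walk of length 11, then for all edges through a pair \<open>b c\<close> the apex lies
  at the same place: always outside of the pair, always at \<open>b\<close>, or always at \<open>c\<close>. If a vertex
  \<open>v\<close> lies in pairs \<open>v x\<close>, \<open>v u\<close>, \<open>v d\<close> whose apexes are at \<open>x\<close>, outside, and at \<open>v\<close>,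
  then the neighbourhoods of these pairs are pairwise disjoint, contradicting their size. To find
  such a \<open>v\<close>, take two edges with apexes \<open>p\<close> and \<open>q\<close>: whatever the apex of an edge through
  \<open>p q\<close> is, one of \<open>p\<close> and \<open>q\<close> will do.

  To obtain cycles rather than closed walks, all choices are made in a positive proportion of
  ways; a six-vertex configuration that occurs with positive density can be blown up.
\<close>

section \<open>Dense sets of lists\<close>

lemma finite_lists_length: "finite V \<Longrightarrow> S \<subseteq> {xs. set xs \<subseteq> V \<and> length xs = m} \<Longrightarrow> finite S"
  by (rule finite_subset, assumption, rule finite_lists_length_eq)

text \<open>Each list in \<open>T\<close> has at least \<open>d\<close> one-element extensions in
  \<open>T'\<close>, and an extension determines both the list and the new entry. Iterating this
  turns "positively many choices at each step" into a count of configurations.\<close>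

lemma card_extend_lists:
  fixes d :: real
  assumes "finite V" and T': "T' \<subseteq> {xs. set xs \<subseteq> V \<and> length xs = m}" and "finite T"
    and ext: "\<And>xs. xs \<in> T \<Longrightarrow> d \<le> real (card {v \<in> V. xs @ [v] \<in> T'})"
  shows "d * real (card T) \<le> real (card T')"
proof -
  let ?A = "\<lambda>xs. {v \<in> V. xs @ [v] \<in> T'}"
  have "d * real (card T) = (\<Sum>xs\<in>T. d)"
    by simp
  also have "\<dots> \<le> (\<Sum>xs\<in>T. real (card (?A xs)))"
    using ext by (intro sum_mono)
  also have "\<dots> = real (card (SIGMA xs:T. ?A xs))"
    using assms by (simp add: card_SigmaI)
  also have "card (SIGMA xs:T. ?A xs) \<le> card T'"
    by (rule card_inj_on_le[where f = "\<lambda>(xs, v). xs @ [v]"])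
      (auto simp: inj_on_def intro: finite_lists_length[OF assms(1) T'])
  finally show ?thesis
    by simp
qed

text \<open>A list is determined by its entries at \<open>js\<close>, for which there are
  \<open>card Q\<close> options, and its entries at the remaining positions \<open>?ks\<close>,
  which are free.\<close>

lemma card_lists_projection_le:
  assumes "finite V" "finite Q" and "distinct js" "set js \<subseteq> {..<m}"
  shows "card {xs. set xs \<subseteq> V \<and> length xs = m \<and> map ((!) xs) js \<in> Q}
    \<le> card Q * card V ^ (m - length js)"
proof -
  let ?ks = "filter (\<lambda>i. i \<notin> set js) [0..<m]"
  have "set ?ks = {..<m} - set js"
    by auto
  moreover have "length ?ks = card (set ?ks)"
    by (simp add: distinct_card flip: set_filter)
  ultimately have len: "length ?ks = m - length js"
    using assms by (simp add: card_Diff_subset distinct_card)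
  let ?f = "\<lambda>xs. (map ((!) xs) js, map ((!) xs) ?ks)"
  have "inj_on ?f {xs. set xs \<subseteq> V \<and> length xs = m \<and> map ((!) xs) js \<in> Q}"
    by (rule inj_onI) (auto simp: map_eq_conv intro!: nth_equalityI)
  moreover have "?f ` {xs. set xs \<subseteq> V \<and> length xs = m \<and> map ((!) xs) js \<in> Q}
    \<subseteq> Q \<times> {ys. set ys \<subseteq> V \<and> length ys = m - length js}"
    using len by (auto intro: subsetD[OF _ nth_mem])
  ultimately have "card {xs. set xs \<subseteq> V \<and> length xs = m \<and> map ((!) xs) js \<in> Q}
    \<le> card (Q \<times> {ys. set ys \<subseteq> V \<and> length ys = m - length js})"
    using assms by (intro card_inj_on_le) (auto simp: finite_lists_length_eq)
  then show ?thesis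
    using assms by (simp add: card_cartesian_product card_lists_length_eq)
qed

section \<open>Erdos's box theorem for dense sets of tuples\<close>

text \<open>The Kovari-Sos-Turan averaging: a positive proportion of the \<open>y\<close> have a
  large \<open>D y\<close>, each of these contains a positive proportion of all
  \<open>t\<close>-sets, so some \<open>t\<close>-set lies in \<open>D y\<close> for a positive
  proportion of the \<open>y\<close>.\<close>

lemma dense_relation_common_subset:
  fixes c :: real and L :: "'b set" and t :: nat
  assumes "c > 0" "t > 0" "finite V" "finite L"
    and large: "t \<le> card V" "2 * real t \<le> c * real (card V)"
    and D: "\<And>y. y \<in> L \<Longrightarrow> D y \<subseteq> V"
    and dense: "c * real (card L) * real (card V) \<le> (\<Sum>y\<in>L. real (card (D y)))"
  obtains T where "T \<subseteq> V" "card T = t"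
    "c / 2 * (c / (2 * real t)) ^ t * real (card L) \<le> real (card {y \<in> L. T \<subseteq> D y})"
proof -
  define n where "n = real (card V)"
  have n: "n > 0"
    using assms n_def by (smt (verit) mult_nonneg_nonpos of_nat_0_less_iff)
  define G where "G = {y \<in> L. c * n / 2 \<le> real (card (D y))}"
  have G: "finite G" "G \<subseteq> L"
    using assms(4) by (auto simp: G_def)
  have cardD: "real (card (D y)) \<le> n" if "y \<in> L" for y
    unfolding n_def using D[OF that] assms(3) by (simp add: card_mono)
  have "c * real (card L) * n \<le> (\<Sum>y\<in>L. real (card (D y)))"
    using dense by (simp add: n_def)
  \<comment> \<open>Outside \<open>G\<close> a summand is below half the average
    \<open>c * n\<close>; inside \<open>G\<close> it is at most \<open>n\<close>.\<close>
  also have "\<dots> \<le> (\<Sum>y\<in>L. (if y \<in> G then n else 0) + c * n / 2)"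
    using cardD assms(1) n by (intro sum_mono) (auto simp: G_def add_increasing2)
  also have "\<dots> = real (card G) * n + real (card L) * (c * n / 2)"
    using G assms(4) by (simp add: sum.distrib sum.If_cases Int_absorb1)
  finally have "c / 2 * real (card L) * n \<le> real (card G) * n"
    by (simp add: field_simps)
  then have cardG: "c / 2 * real (card L) \<le> real (card G)"
    using n by simp
  define \<T> where "\<T> = {T. T \<subseteq> V \<and> card T = t}"
  have fin\<T>: "finite \<T>"
    using assms(3) by (simp add: \<T>_def)
  have ne\<T>: "\<T> \<noteq> {}"
    using obtain_subset_with_card_n[OF large(1)] by (auto simp: \<T>_def)
  have "(c / (2 * real t)) ^ t * n ^ t \<le> real (card {T \<in> \<T>. T \<subseteq> D y})" if "y \<in> G" for y
  proof -
    have y: "c * n / 2 \<le> real (card (D y))" "D y \<subseteq> V" "finite (D y)"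
      using that D G assms(3) by (auto simp: G_def intro: finite_subset)
    have "{T \<in> \<T>. T \<subseteq> D y} = {T. T \<subseteq> D y \<and> card T = t}"
      using y by (auto simp: \<T>_def)
    then have eq: "card {T \<in> \<T>. T \<subseteq> D y} = card (D y) choose t"
      using y n_subsets by metis
    have "real t \<le> real (card (D y))"
      using large y by (simp add: n_def)
    then have "(real (card (D y)) / real t) ^ t \<le> real (card (D y) choose t)"
      using binomial_ge_n_over_k_pow_k[of t "card (D y)", where 'a = real] by simp
    moreover have "(c / (2 * real t) * n) ^ t \<le> (real (card (D y)) / real t) ^ t"
      using y assms n by (intro power_mono) (auto simp: field_simps)
    ultimately show ?thesis
      unfolding eq power_mult_distrib by linarith
  qed
  then have "(\<Sum>y\<in>G. (c / (2 * real t)) ^ t * n ^ t) \<le> (\<Sum>y\<in>G. real (card {T \<in> \<T>. T \<subseteq> D y}))"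
    by (intro sum_mono)
  also have "\<dots> = (\<Sum>T\<in>\<T>. real (card {y \<in> G. T \<subseteq> D y}))"
    using sum.swap_restrict[OF G(1) fin\<T>, of "\<lambda>_ _. 1::real" "\<lambda>y T. T \<subseteq> D y"] by simp
  finally have low: "real (card G) * ((c / (2 * real t)) ^ t * n ^ t)
      \<le> (\<Sum>T\<in>\<T>. real (card {y \<in> G. T \<subseteq> D y}))"
    by simp
  let ?c' = "c / 2 * (c / (2 * real t)) ^ t * real (card L)"
  have "\<exists>T\<in>\<T>. ?c' \<le> real (card {y \<in> G. T \<subseteq> D y})"
  proof (rule ccontr)
    assume neg: "\<not> ?thesis"
    show False
    proof -
      \<comment> \<open>There are at most \<open>n ^ t\<close> sets \<open>T\<close>, so if all of
        them fell below the claimed count, the sum would be below the lower bound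
        \<open>low\<close>.\<close>
      have "(\<Sum>T\<in>\<T>. real (card {y \<in> G. T \<subseteq> D y})) < real (card \<T>) * ?c'"
        using neg fin\<T> ne\<T> by (intro sum_bounded_above_strict) (auto simp: not_le card_gt_0_iff)
      also have "\<dots> \<le> n ^ t * ?c'"
      proof (rule mult_right_mono)
        have "card \<T> = card V choose t"
          using n_subsets[OF assms(3)] by (simp add: \<T>_def)
        moreover have "card V choose t \<le> card V ^ t"
          using assms(3) large(1) by (intro binomial_le_pow) simp
        ultimately show "real (card \<T>) \<le> n ^ t"
          by (metis n_def of_nat_le_iff of_nat_power)
      qed (use assms in auto)
      also have "\<dots> \<le> real (card G) * ((c / (2 * real t)) ^ t * n ^ t)"
        using mult_right_mono[OF cardG, of "(c / (2 * real t)) ^ t * n ^ t"] assms n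
        by (simp add: mult_ac)
      finally show False
        using low by simp
    qed
  qed
  then obtain T where T: "T \<in> \<T>" "?c' \<le> real (card {y \<in> G. T \<subseteq> D y})"
    by blast
  have "card {y \<in> G. T \<subseteq> D y} \<le> card {y \<in> L. T \<subseteq> D y}"
    using G assms(4) by (intro card_mono) auto
  then show thesis
    using T that by (force simp: \<T>_def)
qed


text \<open>Induction on \<open>m\<close>: split off the first entry, find a \<open>t\<close>-set
  \<open>T\<close> of first entries that all extend the same dense set of tails, and apply the
  induction hypothesis to these tails. The sides of the box may overlap.\<close>

lemma dense_lists_contain_box:
  fixes c :: real
  assumes "c > 0" "t > 0"
  shows "\<exists>N. \<forall>(V :: 'a set) S. finite V \<longrightarrow> N \<le> card V \<longrightarrow>
    S \<subseteq> {xs. set xs \<subseteq> V \<and> length xs = m} \<longrightarrow> c * real (card V) ^ m \<le> real (card S) \<longrightarrow>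
    (\<exists>Ts. length Ts = m \<and> (\<forall>T\<in>set Ts. card T = t) \<and> listset Ts \<subseteq> S)"
  using assms(1)
proof (induction m arbitrary: c)
  case 0
  have "\<exists>Ts. length Ts = 0 \<and> (\<forall>T\<in>set Ts. card T = t) \<and> listset Ts \<subseteq> S"
    if "S \<subseteq> {xs. set xs \<subseteq> V \<and> length xs = 0}" "c * real (card V) ^ 0 \<le> real (card S)"
    for V :: "'a set" and S
  proof -
    have "S \<noteq> {}"
      using that 0 by auto
    then have "[] \<in> S"
      using that by auto
    then show ?thesis
      by auto
  qed
  then show ?case
    by blast
next
  case (Suc m)
  define c' where "c' = c / 2 * (c / (2 * real t)) ^ t"
  have "c' > 0"
    using Suc.prems assms(2) by (simp add: c'_def)
  then obtain N where N: "\<And>(V :: 'a set) S. finite V \<Longrightarrow> N \<le> card V \<Longrightarrow>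
      S \<subseteq> {xs. set xs \<subseteq> V \<and> length xs = m} \<Longrightarrow> c' * real (card V) ^ m \<le> real (card S) \<Longrightarrow>
      \<exists>Ts. length Ts = m \<and> (\<forall>T\<in>set Ts. card T = t) \<and> listset Ts \<subseteq> S"
    using Suc.IH by meson
  have "\<exists>Ts. length Ts = Suc m \<and> (\<forall>T\<in>set Ts. card T = t) \<and> listset Ts \<subseteq> S"
    \<comment> \<open>The bound \<open>2 * real t / c\<close> ensures that a set of size
      \<open>c * n / 2\<close> has at least \<open>t\<close> elements.\<close>
    if V: "finite V" "max N (max t (nat \<lceil>2 * real t / c\<rceil>)) \<le> card V"
      and S: "S \<subseteq> {xs. set xs \<subseteq> V \<and> length xs = Suc m}"
      and dense: "c * real (card V) ^ Suc m \<le> real (card S)"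
    for V :: "'a set" and S
  proof -
    define L where "L = {ys. set ys \<subseteq> V \<and> length ys = m}"
    define D where "D = (\<lambda>y. {v \<in> V. v # y \<in> S})"
    have L: "finite L" "card L = card V ^ m"
      using V by (auto simp: L_def finite_lists_length_eq card_lists_length_eq)
    have finD: "finite (D y)" for y
      using V by (simp add: D_def)
    have "2 * real t / c \<le> real (card V)"
      using V(2) by linarith
    then have large: "2 * real t \<le> c * real (card V)"
      using Suc.prems by (simp add: field_simps)
    have "S \<subseteq> (\<lambda>(y, v). v # y) ` (SIGMA y:L. D y)"
    proof
      fix xs assume "xs \<in> S"
      moreover from this obtain v y where "xs = v # y"
        using S by (cases xs) auto
      ultimately show "xs \<in> (\<lambda>(y, v). v # y) ` (SIGMA y:L. D y)"
        using S by (force simp: L_def D_def)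
    qed
    then have "card S \<le> card (SIGMA y:L. D y)"
      using L finD by (intro surj_card_le) auto
    then have "real (card S) \<le> (\<Sum>y\<in>L. real (card (D y)))"
      using L finD by (simp add: card_SigmaI flip: of_nat_sum)
    then have "c * real (card L) * real (card V) \<le> (\<Sum>y\<in>L. real (card (D y)))"
      using dense L by (simp add: mult_ac)
    then obtain T where T: "T \<subseteq> V" "card T = t"
      "c' * real (card L) \<le> real (card {y \<in> L. T \<subseteq> D y})"
      using dense_relation_common_subset[OF Suc.prems assms(2) V(1) L(1) _ large, of D] V(2)
      by (auto simp: c'_def D_def)
    have "\<exists>Ts. length Ts = m \<and> (\<forall>T\<in>set Ts. card T = t) \<and> listset Ts \<subseteq> {y \<in> L. T \<subseteq> D y}"
      by (rule N[OF V(1)]) (use V(2) T(3) L(2) in \<open>auto simp: L_def\<close>)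
    then obtain Ts where Ts: "length Ts = m" "\<forall>T\<in>set Ts. card T = t"
      "listset Ts \<subseteq> {y \<in> L. T \<subseteq> D y}"
      by blast
    have "listset (T # Ts) \<subseteq> S"
      using Ts(3) by (auto simp: set_Cons_def D_def)
    then show ?thesis
      using Ts T by (intro exI[of _ "T # Ts"]) auto
  qed
  then show ?case
    by meson
qed

lemma listset_iff: "xs \<in> listset Ts \<longleftrightarrow> list_all2 (\<in>) xs Ts"
  by (induction Ts arbitrary: xs) (auto simp: set_Cons_def list_all2_Cons2)

text \<open>Greedy choice: fewer than \<open>l\<close> elements are taken when the next set, of size
  at least \<open>l\<close>, is reached. This is why overlapping box sides do no harm.\<close>

lemma distinct_representatives:
  assumes "\<And>i. i < l \<Longrightarrow> l \<le> card (T i)"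
  shows "\<exists>g. inj_on g {..<l} \<and> (\<forall>i<l. g i \<in> T i)"
proof -
  have "\<exists>g. inj_on g {..<k} \<and> (\<forall>i<k. g i \<in> T i)" if "k \<le> l" for k
    using that
  proof (induction k)
    case (Suc k)
    then obtain g where g: "inj_on g {..<k}" "\<forall>i<k. g i \<in> T i"
      by auto
    have "card (g ` {..<k}) < card (T k)"
      using assms[of k] Suc.prems card_image[OF g(1)] by simp
    then obtain v where v: "v \<in> T k" "v \<notin> g ` {..<k}"
      by (metis card_mono finite_imageI finite_lessThan linorder_not_less subsetI)
    have "inj_on (g(k := v)) {..<Suc k}"
      using g v by (auto simp: lessThan_Suc inj_on_def)
    moreover have "\<forall>i<Suc k. (g(k := v)) i \<in> T i"
      using g v by (auto simp: less_Suc_eq)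
    ultimately show ?case
      by blast
  qed simp
  then show ?thesis
    by simp
qed

section \<open>Tight walks\<close>

text \<open>A closed walk with vertex sequence \<open>W\<close> is written below as
  \<open>tight_walk F (W @ take 2 W)\<close>: repeating the first two vertices makes every
  cyclically consecutive triple occur.\<close>

fun tight_walk :: "'a set set \<Rightarrow> 'a list \<Rightarrow> bool" where
  "tight_walk F (x # y # z # ws) \<longleftrightarrow> {x, y, z} \<in> F \<and> tight_walk F (y # z # ws)"
| "tight_walk F ws \<longleftrightarrow> True"

lemma tight_walk_nth:
  "tight_walk F ws \<Longrightarrow> i + 2 < length ws \<Longrightarrow> {ws ! i, ws ! (i + 1), ws ! (i + 2)} \<in> F"
proof (induction F ws arbitrary: i rule: tight_walk.induct)
  case (1 F x y z ws)
  then show ?case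
    by (cases i) auto
qed auto

lemma closed_tight_walk_nth:
  assumes "tight_walk F (W @ take 2 W)" "2 \<le> length W" "i < length W"
  shows "{W ! i, W ! ((i + 1) mod length W), W ! ((i + 2) mod length W)} \<in> F"
proof -
  have "(W @ take 2 W) ! j = W ! (j mod length W)" if "j < length W + 2" for j
    using that assms(2) by (auto simp: nth_append mod_if)
  then show ?thesis
    using tight_walk_nth[OF assms(1), of i] assms(2,3) by (cases "W = []") simp_all
qed

text \<open>Going around one edge lengthens a closed walk by three.\<close>

lemma tight_walk_replicate:
  assumes "tight_walk F (x # y # z # ws)"
  shows "tight_walk F (concat (replicate k [x, y, z]) @ x # y # z # ws)"
proof (induction k)
  case (Suc k)
  obtain ws' where ws': "concat (replicate k [x, y, z]) @ x # y # z # ws = x # y # z # ws'"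
    by (cases k) auto
  have "{y, z, x} = {x, y, z}" "{z, x, y} = {x, y, z}"
    by auto
  then show ?case
    using Suc assms by (simp add: ws')
qed (use assms in simp)

text \<open>Blow-up argument: a dense set of homomorphisms from \<open>F\<close> contains a box with
  sides of size \<open>length W\<close>. Replacing the \<open>i\<close>-th vertex of the closed walk
  by its own representative in the side belonging to \<open>W ! i\<close> turns the walk into a
  cycle.\<close>

lemma dense_homs_contain_tight_cycle:
  fixes c :: real and F :: "nat set set"
  assumes "c > 0" and F: "\<And>e. e \<in> F \<Longrightarrow> e \<subseteq> {..<m} \<and> card e = 3"
    and W: "tight_walk F (W @ take 2 W)" "2 \<le> length W"
  shows "\<exists>N. \<forall>H :: 'a hypergraph. finite (verts H) \<longrightarrow> N \<le> card (verts H) \<longrightarrow>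
    c * real (card (verts H)) ^ m \<le> real (card {xs. set xs \<subseteq> verts H \<and> length xs = m \<and>
      (\<forall>e\<in>F. (!) xs ` e \<in> edges H)}) \<longrightarrow>
    contains_copy H (tight_cycle (length W))"
proof -
  define l where "l = length W"
  have l: "l > 0"
    using W(2) by (auto simp: l_def)
  obtain N where N: "\<And>(V :: 'a set) S. finite V \<Longrightarrow> N \<le> card V \<Longrightarrow>
      S \<subseteq> {xs. set xs \<subseteq> V \<and> length xs = m} \<Longrightarrow> c * real (card V) ^ m \<le> real (card S) \<Longrightarrow>
      \<exists>Ts. length Ts = m \<and> (\<forall>T\<in>set Ts. card T = l) \<and> listset Ts \<subseteq> S"
    using dense_lists_contain_box[OF assms(1) l, where m = m and 'a = 'a] by meson
  have "contains_copy H (tight_cycle l)"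
    if H: "finite (verts H)" "N \<le> card (verts H)"
      and dense: "c * real (card (verts H)) ^ m \<le> real (card {xs. set xs \<subseteq> verts H \<and>
        length xs = m \<and> (\<forall>e\<in>F. (!) xs ` e \<in> edges H)})" (is "_ \<le> real (card ?S)")
    for H :: "'a hypergraph"
  proof -
    obtain Ts where Ts: "length Ts = m" "\<forall>T\<in>set Ts. card T = l" "listset Ts \<subseteq> ?S"
      using N[OF H _ dense] by blast
    have edge: "{W ! i, W ! ((i + 1) mod l), W ! ((i + 2) mod l)} \<in> F" if "i < l" for i
      using closed_tight_walk_nth[OF W, of i] that by (simp add: l_def)
    have Wm: "W ! i < m" if "i < l" for i
      using F[OF edge[OF that]] by simp
    obtain g where g: "inj_on g {..<l}" "\<forall>i<l. g i \<in> Ts ! (W ! i)"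
      using distinct_representatives[of l "\<lambda>i. Ts ! (W ! i)"] Ts Wm by auto
    have ne: "Ts ! j \<noteq> {}" if "j < m" for j
      using Ts that l by (metis card.empty nth_mem order_less_irrefl)
    have hom: "(!) xs ` e \<in> edges H" "set xs \<subseteq> verts H"
      if "length xs = m" "\<And>j. j < m \<Longrightarrow> xs ! j \<in> Ts ! j" "e \<in> F" for xs e
    proof -
      have "xs \<in> listset Ts"
        using that Ts(1) by (simp add: listset_iff list_all2_conv_all_nth)
      then show "(!) xs ` e \<in> edges H" "set xs \<subseteq> verts H"
        using Ts(3) that(3) by blast+
    qed
    have main: "{g i, g ((i + 1) mod l), g ((i + 2) mod l)} \<in> edges H \<and> g i \<in> verts H"
      if i: "i < l" for i
    proof -
      let ?j = "(i + 1) mod l" and ?k = "(i + 2) mod l"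
      have jk: "?j < l" "?k < l"
        using l by auto
      have "card {W ! i, W ! ?j, W ! ?k} = 3"
        using F[OF edge[OF i]] by blast
      then have dist: "W ! i \<noteq> W ! ?j" "W ! i \<noteq> W ! ?k" "W ! ?j \<noteq> W ! ?k"
        by (auto simp: card_insert_if split: if_splits)
      \<comment> \<open>A member of the box with prescribed values at the three walk vertices and
        arbitrary values elsewhere. The updates do not clash, since the three vertices form an edge
        and hence are distinct.\<close>
      define h where "h = ((\<lambda>p. SOME v. v \<in> Ts ! p)(W ! i := g i, W ! ?j := g ?j, W ! ?k := g ?k))"
      define xs where "xs = map h [0..<m]"
      have "h p \<in> Ts ! p" if "p < m" for p
        using ne[OF that] g(2) i jk by (auto simp: h_def some_in_eq)
      then have xs: "length xs = m" "\<And>p. p < m \<Longrightarrow> xs ! p \<in> Ts ! p"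
        by (auto simp: xs_def)
      have eq: "xs ! (W ! i) = g i" "xs ! (W ! ?j) = g ?j" "xs ! (W ! ?k) = g ?k"
        using Wm i jk dist by (auto simp: xs_def h_def)
      have "(!) xs ` {W ! i, W ! ?j, W ! ?k} = {g i, g ?j, g ?k}"
        by (simp only: image_insert image_empty eq)
      moreover have "g i \<in> set xs"
        using eq(1) Wm[OF i] xs(1) nth_mem by metis
      ultimately show ?thesis
        using hom[OF xs edge[OF i]] by auto
    qed
    show ?thesis
      unfolding contains_copy_def tight_cycle_def
      using g(1) main by (intro exI[of _ g]) auto
  qed
  then show ?thesis
    unfolding l_def by blast
qed


section \<open>Apexes of edges\<close>

text \<open>A Bonferroni inequality, applied to \<open>A \<union> B \<union> C\<close> inside
  \<open>V\<close>.\<close>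

lemma card_three_subsets_le:
  assumes "finite V" "A \<subseteq> V" "B \<subseteq> V" "C \<subseteq> V"
  shows "card A + card B + card C \<le> card V + card (A \<inter> B) + card (A \<inter> C) + card (B \<inter> C)"
proof -
  have fin: "finite A" "finite B" "finite C"
    using assms by (auto intro: finite_subset)
  have "card A + card B = card (A \<union> B) + card (A \<inter> B)"
    using fin by (intro card_Un_Int)
  moreover have "card (A \<union> B) + card C = card (A \<union> B \<union> C) + card ((A \<union> B) \<inter> C)"
    using fin by (intro card_Un_Int) auto
  moreover have "card ((A \<union> B) \<inter> C) \<le> card (A \<inter> C) + card (B \<inter> C)"
    unfolding Int_Un_distrib2 by (rule card_Un_le)
  moreover have "card (A \<union> B \<union> C) \<le> card V"
    using assms by (intro card_mono) auto
  ultimately show ?thesis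
    by linarith
qed

text \<open>The six-vertex graphs spanned by a conflict at the pair of the vertices 1 and \<open>k\<close>, for \<open>k = 0\<close>
  and \<open>k = 2\<close>: each of the edges \<open>{0, 1, 2}\<close> with apex 0 and \<open>{1, k, 3}\<close> with apex 1 is completed
  by a common neighbour, 4 and 5 respectively, of the two pairs at its apex.\<close>

definition pattern :: "nat \<Rightarrow> nat set set" where
  "pattern k = {{0, 1, 2}, {0, 1, 4}, {0, 2, 4}, {1, k, 3}, {1, k, 5}, {1, 3, 5}}"

text \<open>The bound 15 makes a third of the vertices at least five, so a new vertex can avoid up
  to five earlier ones and still have \<open>\<epsilon> * n\<close> choices.\<close>

locale dense_3graph =
  fixes H :: "'a hypergraph" and \<epsilon> :: real
  assumes H: "is_3graph H"
    and eps: "0 < \<epsilon>"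
    and large: "15 \<le> card (verts H)"
    and codeg: "\<And>u v. u \<in> verts H \<Longrightarrow> v \<in> verts H \<Longrightarrow> u \<noteq> v \<Longrightarrow>
      (1 / 3 + \<epsilon>) * real (card (verts H)) \<le> real (codegree H u v)"
begin

abbreviation V where "V \<equiv> verts H"
abbreviation E where "E \<equiv> edges H"
abbreviation n where "n \<equiv> real (card V)"
abbreviation N where "N u v \<equiv> {w \<in> V. {u, v, w} \<in> E}"

lemma finV [simp]: "finite V"
  using H by (simp add: is_3graph_def)

lemma edgeD:
  assumes "{a, b, c} \<in> E"
  shows "a \<in> V" "b \<in> V" "c \<in> V" "a \<noteq> b" "a \<noteq> c" "b \<noteq> c"
proof -
  have "{a, b, c} \<subseteq> V" "card {a, b, c} = 3"
    using H assms by (auto simp: is_3graph_def)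
  then show "a \<in> V" "b \<in> V" "c \<in> V" "a \<noteq> b" "a \<noteq> c" "b \<noteq> c"
    by (auto simp: card_insert_if split: if_splits)
qed

lemma card_N: "u \<in> V \<Longrightarrow> v \<in> V \<Longrightarrow> u \<noteq> v \<Longrightarrow> (1 / 3 + \<epsilon>) * n \<le> real (card (N u v))"
  using codeg by (simp add: codegree_def)

lemma eps_le: "\<epsilon> \<le> 2 / 3"
proof -
  have "\<not> card V \<le> Suc 0"
    using large by simp
  then obtain u v where "u \<in> V" "v \<in> V" "u \<noteq> v"
    using card_le_Suc0_iff_eq[OF finV] by auto
  then have "(1 / 3 + \<epsilon>) * n \<le> real (card (N u v))"
    by (rule card_N)
  also have "\<dots> \<le> 1 * n"
    by (simp add: card_mono)
  finally show ?thesis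
    using large by (subst (asm) mult_le_cancel_right) auto
qed

text \<open>Three sets of size at least \<open>n / 3 + \<epsilon> * n\<close> exceed
  \<open>n\<close> by \<open>3 * \<epsilon> * n\<close> in total, and the pairwise intersections
  must absorb this excess.\<close>

lemma two_of_three_intersect:
  assumes "u1 \<in> V" "v1 \<in> V" "u1 \<noteq> v1" "u2 \<in> V" "v2 \<in> V" "u2 \<noteq> v2" "u3 \<in> V" "v3 \<in> V" "u3 \<noteq> v3"
  shows "\<epsilon> * n \<le> real (card (N u1 v1 \<inter> N u2 v2)) \<or> \<epsilon> * n \<le> real (card (N u1 v1 \<inter> N u3 v3))
    \<or> \<epsilon> * n \<le> real (card (N u2 v2 \<inter> N u3 v3))"
proof -
  let ?A = "N u1 v1" and ?B = "N u2 v2" and ?C = "N u3 v3"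
  have "card ?A + card ?B + card ?C
      \<le> card V + card (?A \<inter> ?B) + card (?A \<inter> ?C) + card (?B \<inter> ?C)"
    by (rule card_three_subsets_le) auto
  then have "real (card ?A) + real (card ?B) + real (card ?C)
      \<le> n + real (card (?A \<inter> ?B)) + real (card (?A \<inter> ?C)) + real (card (?B \<inter> ?C))"
    by linarith
  moreover have "n / 3 + \<epsilon> * n \<le> real (card ?A)" "n / 3 + \<epsilon> * n \<le> real (card ?B)"
    "n / 3 + \<epsilon> * n \<le> real (card ?C)"
    using card_N assms by (simp_all add: distrib_right)
  ultimately show ?thesis
    by linarith
qed

text \<open>The first argument is the apex; an edge may have several. Asking for
  \<open>\<epsilon> * n\<close> common neighbours, not just one, keeps all later counts
  dense.\<close>

definition apex :: "'a \<Rightarrow> 'a \<Rightarrow> 'a \<Rightarrow> bool" where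
  "apex a b c \<longleftrightarrow> {a, b, c} \<in> E \<and> \<epsilon> * n \<le> real (card (N a b \<inter> N a c))"

lemma apex_commute: "apex a b c \<longleftrightarrow> apex a c b"
  by (simp add: apex_def insert_commute Int_commute)

lemma edge_has_apex:
  assumes "{a, b, c} \<in> E"
  shows "apex a b c \<or> apex b a c \<or> apex c a b"
  using two_of_three_intersect[of a b a c b c] edgeD[OF assms] assms
  by (auto simp: apex_def insert_commute Int_commute)

text \<open>Two edges through a pair \<open>{b, c}\<close> are in conflict if their apexes lie at different places
  relative to that pair: \<open>apex a b c\<close> lies outside of it, whereas \<open>apex b c e\<close> and \<open>apex c b g\<close>
  single out one of its ends.\<close>

definition conflict_out :: "'a list set" where
  "conflict_out = {[a, b, c, e] | a b c e. apex a b c \<and> apex b c e}"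

definition conflict_in :: "'a list set" where
  "conflict_in = {[b, c, e, g] | b c e g. apex b c e \<and> apex c b g}"

lemma conflict_subset:
  "conflict_out \<subseteq> {xs. set xs \<subseteq> V \<and> length xs = 4}"
  "conflict_in \<subseteq> {xs. set xs \<subseteq> V \<and> length xs = 4}"
  by (auto simp: conflict_out_def conflict_in_def apex_def dest: edgeD)

lemma finite_conflict: "finite conflict_out" "finite conflict_in"
  by (rule finite_lists_length[OF finV] conflict_subset)+

text \<open>Without conflicts, the edges \<open>{x, v, u}\<close> and \<open>{v, d, d'}\<close>
  dictate the apex of any edge \<open>{v, x, w}\<close>, \<open>{v, u, w}\<close> or
  \<open>{v, d, w}\<close>: it is \<open>x\<close>, \<open>w\<close> and \<open>v\<close>
  respectively. Relative to the pair of \<open>v\<close> and \<open>w\<close> these are three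
  different places, so any two of the edges conflict. The conflict is given by positions
  \<open>js\<close> so that it can be located inside longer lists.\<close>

lemma forced_conflict:
  assumes "apex x v u" "apex v d d'"
    and "{v, x, w} \<in> E \<and> {v, u, w} \<in> E \<or> {v, x, w} \<in> E \<and> {v, d, w} \<in> E \<or>
      {v, u, w} \<in> E \<and> {v, d, w} \<in> E"
  shows "\<exists>js. distinct js \<and> set js \<subseteq> {..<6} \<and> length js = 4 \<and>
    map ((!) [x, v, u, d, d', w]) js \<in> conflict_out \<union> conflict_in"
proof (rule ccontr)
  assume neg: "\<not> ?thesis"
  have free: "\<not> (distinct js \<and> set js \<subseteq> {..<6} \<and> length js = 4 \<and>
    map ((!) [x, v, u, d, d', w]) js \<in> conflict_out \<union> conflict_in)" for js
    using neg by blast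
  \<comment> \<open>The lists of positions given to \<open>free\<close> name the conflicts that the
    two other possible apexes would create.\<close>
  have vxw: "apex x v w" if "{v, x, w} \<in> E"
    using edge_has_apex[OF that] assms(1) free[of "[1, 0, 5, 2]"] free[of "[5, 0, 1, 2]"]
    by (auto simp: conflict_out_def conflict_in_def apex_commute)
  have vuw: "apex w v u" if "{v, u, w} \<in> E"
    using edge_has_apex[OF that] assms(1) free[of "[0, 1, 2, 5]"] free[of "[0, 2, 1, 5]"]
    by (auto simp: conflict_out_def apex_commute)
  have vdw: "apex v d w" if "{v, d, w} \<in> E"
    using edge_has_apex[OF that] assms(2) free[of "[1, 3, 4, 5]"] free[of "[5, 1, 3, 4]"]
    by (auto simp: conflict_out_def conflict_in_def apex_commute)
  \<comment> \<open>All three conflicts are at the pair of positions 1 and 5, that is,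
    \<open>v\<close> and \<open>w\<close>.\<close>
  show False
    using assms(3) vxw vuw vdw free[of "[0, 5, 1, 2]"] free[of "[0, 1, 5, 3]"] free[of "[5, 1, 2, 3]"]
    by (auto simp: conflict_out_def conflict_in_def apex_commute)
qed

section \<open>Counting conflicts\<close>

text \<open>Partial choices of two disjoint edges: the guards on \<open>k\<close> demand an edge
  only once its third vertex is present, which allows adding one vertex at a time.\<close>

definition two_edges :: "nat \<Rightarrow> 'a list set" where
  "two_edges k = {xs. set xs \<subseteq> V \<and> length xs = k \<and> distinct xs \<and>
     (3 \<le> k \<longrightarrow> {xs ! 0, xs ! 1, xs ! 2} \<in> E) \<and> (6 \<le> k \<longrightarrow> {xs ! 3, xs ! 4, xs ! 5} \<in> E)}"

lemma two_edges_subset: "two_edges k \<subseteq> {xs. set xs \<subseteq> V \<and> length xs = k}"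
  by (auto simp: two_edges_def)

lemma card_two_edges_Suc:
  assumes "k < 6"
  shows "\<epsilon> * n * real (card (two_edges k)) \<le> real (card (two_edges (Suc k)))"
proof (rule card_extend_lists[OF finV])
  fix xs assume xs: "xs \<in> two_edges k"
  have k: "k \<in> {0, 1, 2, 3, 4, 5}"
    using assms by auto
  \<comment> \<open>The next vertex completes an edge exactly when \<open>k\<close> is 2 or 5;
    otherwise it is unrestricted. By \<open>eps_le\<close>, all of \<open>V\<close> also meets the
    lower bound for neighbourhoods.\<close>
  define A where "A = (if k = 2 then N (xs ! 0) (xs ! 1) else if k = 5 then N (xs ! 3) (xs ! 4) else V)"
  have "xs ! i \<in> V" if "i < k" for i
    using xs that by (auto simp: two_edges_def)
  moreover have "xs ! i \<noteq> xs ! j" if "i < j" "j < k" for i j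
    using xs that by (auto simp: two_edges_def nth_eq_iff_index_eq)
  moreover have "(1 / 3 + \<epsilon>) * n \<le> 1 * n"
    using eps_le by (intro mult_right_mono) auto
  ultimately have "(1 / 3 + \<epsilon>) * n \<le> real (card A)"
    using card_N by (auto simp: A_def)
  moreover have "real (card A) - real (card (set xs)) \<le> real (card (A - set xs))"
    using diff_card_le_card_Diff[of "set xs" A] by auto
  moreover have "card (set xs) \<le> 5"
    using xs assms by (simp add: two_edges_def distinct_card)
  ultimately have "\<epsilon> * n \<le> real (card (A - set xs))"
    using large by (simp add: distrib_right)
  also have "A - set xs \<subseteq> {v \<in> V. xs @ [v] \<in> two_edges (Suc k)}"
    using k xs by (auto simp: two_edges_def A_def nth_append split: if_splits)
  then have "real (card (A - set xs)) \<le> real (card {v \<in> V. xs @ [v] \<in> two_edges (Suc k)})"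
    by (simp add: card_mono)
  finally show "\<epsilon> * n \<le> real (card {v \<in> V. xs @ [v] \<in> two_edges (Suc k)})" .
qed (rule two_edges_subset, rule finite_lists_length[OF finV two_edges_subset])

lemma card_two_edges: "k \<le> 6 \<Longrightarrow> (\<epsilon> * n) ^ k \<le> real (card (two_edges k))"
proof (induction k)
  case 0
  have "two_edges 0 = {[]}"
    by (auto simp: two_edges_def)
  then show ?case
    by simp
next
  case (Suc k)
  then have "\<epsilon> * n * (\<epsilon> * n) ^ k \<le> \<epsilon> * n * real (card (two_edges k))"
    using eps by (intro mult_left_mono) auto
  then show ?case
    using card_two_edges_Suc[of k] Suc.prems by simp
qed

text \<open>Lists containing a vertex \<open>v\<close> to which \<open>forced_conflict\<close>
  applies. The positions are quantified because they depend on where the apexes lie.\<close>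

definition cherries :: "'a list set" where
  "cherries = {xs. set xs \<subseteq> V \<and> length xs = 7 \<and> (\<exists>x v u d d'. distinct [x, v, u, d, d'] \<and>
     set [x, v, u, d, d'] \<subseteq> {..<7} \<and> apex (xs ! x) (xs ! v) (xs ! u) \<and>
     apex (xs ! v) (xs ! d) (xs ! d'))}"

lemma cherries_subset: "cherries \<subseteq> {xs. set xs \<subseteq> V \<and> length xs = 7}"
  by (auto simp: cherries_def)

lemma cherriesI:
  assumes "set xs \<subseteq> V" "length xs = 7" "distinct [x, v, u, d, d']"
    "x < 7" "v < 7" "u < 7" "d < 7" "d' < 7"
    "apex (xs ! x) (xs ! v) (xs ! u)" "apex (xs ! v) (xs ! d) (xs ! d')"
  shows "xs \<in> cherries"
proof -
  have "set [x, v, u, d, d'] \<subseteq> {..<7}"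
    using assms by simp
  with assms show ?thesis
    unfolding cherries_def by blast
qed

text \<open>Let \<open>p\<close> and \<open>q\<close> be apexes of the two edges and
  \<open>z\<close> any common neighbour of the pair. If \<open>p\<close> is an apex of
  \<open>{p, q, z}\<close>, then \<open>q\<close> serves as \<open>v\<close>; if \<open>q\<close> or
  \<open>z\<close> is one, then \<open>p\<close> does. The edge on which \<open>v\<close> itself is
  an apex is the original one.\<close>

lemma card_cherries: "\<epsilon> * n * real (card (two_edges 6)) \<le> real (card cherries)"
proof (rule card_extend_lists[OF finV])
  fix xs assume xs: "xs \<in> two_edges 6"
  have e: "{xs ! 0, xs ! 1, xs ! 2} \<in> E" "{xs ! 3, xs ! 4, xs ! 5} \<in> E"
    and len: "length xs = 6" "distinct xs" "set xs \<subseteq> V"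
    using xs by (auto simp: two_edges_def)
  obtain p p1 p2 where p: "p < 3" "p1 < 3" "p2 < 3" "p \<noteq> p1" "p \<noteq> p2" "p1 \<noteq> p2"
    "apex (xs ! p) (xs ! p1) (xs ! p2)"
    using edge_has_apex[OF e(1)]
  proof (elim disjE)
    assume "apex (xs ! 0) (xs ! 1) (xs ! 2)"
    then show thesis
      by (intro that[of 0 1 2]) auto
  next
    assume "apex (xs ! 1) (xs ! 0) (xs ! 2)"
    then show thesis
      by (intro that[of 1 0 2]) auto
  next
    assume "apex (xs ! 2) (xs ! 0) (xs ! 1)"
    then show thesis
      by (intro that[of 2 0 1]) auto
  qed
  obtain q q1 q2 where q: "q \<in> {3..<6}" "q1 \<in> {3..<6}" "q2 \<in> {3..<6}" "q \<noteq> q1" "q \<noteq> q2" "q1 \<noteq> q2"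
    "apex (xs ! q) (xs ! q1) (xs ! q2)"
    using edge_has_apex[OF e(2)]
  proof (elim disjE)
    assume "apex (xs ! 3) (xs ! 4) (xs ! 5)"
    then show thesis
      by (intro that[of 3 4 5]) auto
  next
    assume "apex (xs ! 4) (xs ! 3) (xs ! 5)"
    then show thesis
      by (intro that[of 4 3 5]) auto
  next
    assume "apex (xs ! 5) (xs ! 3) (xs ! 4)"
    then show thesis
      by (intro that[of 5 3 4]) auto
  qed
  have "xs ! p \<in> V" "xs ! q \<in> V" "xs ! p \<noteq> xs ! q"
    using len p q by (auto simp: nth_eq_iff_index_eq subsetD[OF len(3)])
  then have "(1 / 3 + \<epsilon>) * n \<le> real (card (N (xs ! p) (xs ! q)))"
    by (rule card_N)
  moreover have "\<epsilon> * n \<le> (1 / 3 + \<epsilon>) * n"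
    by (simp add: distrib_right)
  moreover have "N (xs ! p) (xs ! q) \<subseteq> {z \<in> V. xs @ [z] \<in> cherries}"
  proof safe
    fix z assume z: "z \<in> V" "{xs ! p, xs ! q, z} \<in> E"
    have nth: "(xs @ [z]) ! 6 = z" "\<And>i. i < 6 \<Longrightarrow> (xs @ [z]) ! i = xs ! i"
      using len by (simp_all add: nth_append)
    show "xs @ [z] \<in> cherries"
      using edge_has_apex[OF z(2)]
    proof (elim disjE)
      assume "apex (xs ! p) (xs ! q) z"
      then show ?thesis
        by (intro cherriesI[of _ p q 6 q1 q2]) (use p q z len in \<open>auto simp: nth\<close>)
    next
      assume "apex (xs ! q) (xs ! p) z"
      then show ?thesis
        by (intro cherriesI[of _ q p 6 p1 p2]) (use p q z len in \<open>auto simp: nth\<close>)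
    next
      assume "apex z (xs ! p) (xs ! q)"
      then show ?thesis
        by (intro cherriesI[of _ 6 p q p1 p2]) (use p q z len in \<open>auto simp: nth\<close>)
    qed
  qed
  then have "card (N (xs ! p) (xs ! q)) \<le> card {z \<in> V. xs @ [z] \<in> cherries}"
    by (intro card_mono) auto
  ultimately show "\<epsilon> * n \<le> real (card {z \<in> V. xs @ [z] \<in> cherries})"
    by linarith
qed (rule cherries_subset, rule finite_lists_length[OF finV two_edges_subset])

definition conflicting :: "'a list set" where
  "conflicting = {xs. set xs \<subseteq> V \<and> length xs = 8 \<and> (\<exists>js. distinct js \<and> set js \<subseteq> {..<8} \<and>
     length js = 4 \<and> map ((!) xs) js \<in> conflict_out \<union> conflict_in)}"

lemma conflicting_subset: "conflicting \<subseteq> {xs. set xs \<subseteq> V \<and> length xs = 8}"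
  by (auto simp: conflicting_def)

text \<open>Two of the neighbourhoods of the pairs \<open>v x\<close>, \<open>v u\<close>,
  \<open>v d\<close> share at least \<open>\<epsilon> * n\<close> vertices \<open>w\<close>, and
  each of them yields a conflict by \<open>forced_conflict\<close>.\<close>

lemma card_conflicting_ge: "\<epsilon> * n * real (card cherries) \<le> real (card conflicting)"
proof (rule card_extend_lists[OF finV])
  fix xs assume "xs \<in> cherries"
  then obtain x v u d d' where len: "length xs = 7" "set xs \<subseteq> V" and
    dist: "distinct [x, v, u, d, d']" "set [x, v, u, d, d'] \<subseteq> {..<7}" and
    apex: "apex (xs ! x) (xs ! v) (xs ! u)" "apex (xs ! v) (xs ! d) (xs ! d')"
    unfolding cherries_def by blast
  let ?W = "{w \<in> V. xs @ [w] \<in> conflicting}"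
  have mem: "w \<in> ?W" if "w \<in> V" and w: "{xs ! v, xs ! x, w} \<in> E \<and> {xs ! v, xs ! u, w} \<in> E \<or>
      {xs ! v, xs ! x, w} \<in> E \<and> {xs ! v, xs ! d, w} \<in> E \<or>
      {xs ! v, xs ! u, w} \<in> E \<and> {xs ! v, xs ! d, w} \<in> E" for w
  proof -
    obtain js where js: "distinct js" "set js \<subseteq> {..<6}" "length js = 4"
      "map ((!) [xs ! x, xs ! v, xs ! u, xs ! d, xs ! d', w]) js \<in> conflict_out \<union> conflict_in"
      using forced_conflict[OF apex w] by blast
    \<comment> \<open>Translates positions in the six-vertex list into positions in
      \<open>xs @ [w]\<close>, where \<open>w\<close> has index 7.\<close>
    define ks where "ks = [x, v, u, d, d', 7]"
    have ks: "distinct ks" "set ks \<subseteq> {..<8}" "length ks = 6"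
      using dist by (auto simp: ks_def)
    have "map ((!) (xs @ [w])) ks = [xs ! x, xs ! v, xs ! u, xs ! d, xs ! d', w]"
      using dist len by (simp add: nth_append ks_def)
    then have "(xs @ [w]) ! (ks ! j) = [xs ! x, xs ! v, xs ! u, xs ! d, xs ! d', w] ! j"
      if "j < 6" for j
      using that ks(3) by (metis nth_map)
    then have "map ((!) (xs @ [w])) (map ((!) ks) js)
        = map ((!) [xs ! x, xs ! v, xs ! u, xs ! d, xs ! d', w]) js"
      using js(2) by auto
    moreover have "distinct (map ((!) ks) js)"
      using js ks by (auto simp: distinct_map inj_on_def nth_eq_iff_index_eq subset_iff)
    moreover have "set (map ((!) ks) js) \<subseteq> {..<8}"
    proof -
      have "ks ! j \<in> set ks" if "j \<in> set js" for j
        using that js(2) ks(3) by (intro nth_mem) auto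
      then show ?thesis
        using ks(2) by auto
    qed
    ultimately have "\<exists>is. distinct is \<and> set is \<subseteq> {..<8} \<and> length is = 4 \<and>
        map ((!) (xs @ [w])) is \<in> conflict_out \<union> conflict_in"
      using js(3,4) by (intro exI[of _ "map ((!) ks) js"]) (simp del: map_map)
    then show ?thesis
      using that(1) len by (simp add: conflicting_def)
  qed
  let ?A = "N (xs ! v) (xs ! x)" and ?B = "N (xs ! v) (xs ! u)" and ?C = "N (xs ! v) (xs ! d)"
  have "card (?A \<inter> ?B) \<le> card ?W" "card (?A \<inter> ?C) \<le> card ?W" "card (?B \<inter> ?C) \<le> card ?W"
    using mem by (intro card_mono; force)+
  moreover have "\<epsilon> * n \<le> real (card (?A \<inter> ?B)) \<or> \<epsilon> * n \<le> real (card (?A \<inter> ?C)) \<or>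
      \<epsilon> * n \<le> real (card (?B \<inter> ?C))"
    using apex by (intro two_of_three_intersect) (auto simp: apex_def dest: edgeD)
  ultimately show "\<epsilon> * n \<le> real (card ?W)"
    by linarith
qed (rule conflicting_subset, rule finite_lists_length[OF finV cherries_subset])

text \<open>Union bound over the \<open>8 ^ 4 = 4096\<close> lists of positions; each fixes four
  entries to form a conflict and leaves four free.\<close>

lemma card_conflicting_le:
  "card conflicting \<le> 4096 * (card conflict_out + card conflict_in) * card V ^ 4"
proof -
  define J where "J = {js. set js \<subseteq> {..<8::nat} \<and> length js = 4}"
  let ?Q = "conflict_out \<union> conflict_in"
  let ?C = "\<lambda>js. {xs. set xs \<subseteq> V \<and> length xs = 8 \<and> map ((!) xs) js \<in> ?Q}"
  have J: "finite J" "card J = 4096"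
    by (simp_all add: J_def finite_lists_length_eq card_lists_length_eq)
  have "conflicting \<subseteq> (\<Union>js\<in>{js \<in> J. distinct js}. ?C js)"
    by (auto simp: conflicting_def J_def)
  then have "card conflicting \<le> card (\<Union>js\<in>{js \<in> J. distinct js}. ?C js)"
    using J by (intro card_mono) (auto intro: finite_lists_length[OF finV, of _ 8])
  also have "\<dots> \<le> (\<Sum>js\<in>{js \<in> J. distinct js}. card (?C js))"
    using J by (intro card_UN_le) auto
  also have "\<dots> \<le> (\<Sum>js\<in>{js \<in> J. distinct js}. card ?Q * card V ^ 4)"
  proof (rule sum_mono)
    fix js assume "js \<in> {js \<in> J. distinct js}"
    then show "card (?C js) \<le> card ?Q * card V ^ 4"
      using card_lists_projection_le[of V ?Q js 8] finite_conflict by (auto simp: J_def)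
  qed
  also have "\<dots> = card {js \<in> J. distinct js} * (card ?Q * card V ^ 4)"
    by simp
  also have "\<dots> \<le> card J * (card ?Q * card V ^ 4)"
    using J by (intro mult_right_mono card_mono) auto
  also have "\<dots> \<le> card J * ((card conflict_out + card conflict_in) * card V ^ 4)"
    by (intro mult_left_mono mult_right_mono card_Un_le) auto
  finally show ?thesis
    by (simp only: J mult.assoc)
qed

text \<open>Six vertices for two edges, one for the cherry and one for the conflict give
  \<open>(\<epsilon> * n) ^ 8\<close> lists. Dividing by \<open>4096 * n ^ 4\<close> bounds the
  conflicts of both kinds together, and one kind has at least half.\<close>

lemma many_conflicts:
  "\<epsilon> ^ 8 / 8192 * n ^ 4 \<le> real (card conflict_out) \<or> \<epsilon> ^ 8 / 8192 * n ^ 4 \<le> real (card conflict_in)"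
proof (rule ccontr)
  assume "\<not> ?thesis"
  then have less: "real (card conflict_out) + real (card conflict_in) < \<epsilon> ^ 8 / 4096 * n ^ 4"
    by (simp add: not_le)
  have n: "n > 0"
    using large by simp
  have "(\<epsilon> * n) ^ 8 = \<epsilon> * n * (\<epsilon> * n * (\<epsilon> * n) ^ 6)"
    by (simp add: eval_nat_numeral)
  also have "\<dots> \<le> \<epsilon> * n * (\<epsilon> * n * real (card (two_edges 6)))"
    using card_two_edges[of 6] eps by (intro mult_left_mono) auto
  also have "\<dots> \<le> \<epsilon> * n * real (card cherries)"
    using card_cherries eps by (intro mult_left_mono) auto
  also have "\<dots> \<le> real (card conflicting)"
    by (rule card_conflicting_ge)
  also have "\<dots> \<le> 4096 * (real (card conflict_out) + real (card conflict_in)) * n ^ 4"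
    using of_nat_mono[OF card_conflicting_le, where 'a = real] by simp
  also have "\<dots> < 4096 * (\<epsilon> ^ 8 / 4096 * n ^ 4) * n ^ 4"
    using less n by (intro mult_strict_right_mono mult_strict_left_mono) auto
  also have "\<dots> = (\<epsilon> * n) ^ 8"
    by (simp add: power_mult_distrib flip: power_add)
  finally show False
    by simp
qed

section \<open>From conflicts to homomorphisms of the six-vertex patterns\<close>

text \<open>Each of the two apexes offers \<open>\<epsilon> * n\<close> completing vertices, for
  positions 4 and 5. These may coincide with earlier vertices, as only homomorphisms are
  counted.\<close>

lemma card_pattern_homs:
  assumes Q: "Q \<subseteq> {xs. set xs \<subseteq> V \<and> length xs = 4}" and k: "k = 0 \<or> k = 2"
    and apex: "\<And>xs. xs \<in> Q \<Longrightarrow> apex (xs ! 0) (xs ! 1) (xs ! 2) \<and> apex (xs ! 1) (xs ! k) (xs ! 3)"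
  shows "(\<epsilon> * n)\<^sup>2 * real (card Q) \<le> real (card {xs. set xs \<subseteq> V \<and> length xs = 6 \<and>
    (\<forall>e\<in>pattern k. (!) xs ` e \<in> E)})" (is "_ \<le> real (card ?S)")
proof -
  define T where "T = {xs @ [d] | xs d. xs \<in> Q \<and> d \<in> N (xs ! 0) (xs ! 1) \<inter> N (xs ! 0) (xs ! 2)}"
  have T: "T \<subseteq> {xs. set xs \<subseteq> V \<and> length xs = 5}"
    by (auto simp: T_def dest!: subsetD[OF Q])
  have "\<epsilon> * n * real (card Q) \<le> real (card T)"
  proof (rule card_extend_lists[OF finV])
    fix xs assume xs: "xs \<in> Q"
    then have "\<epsilon> * n \<le> real (card (N (xs ! 0) (xs ! 1) \<inter> N (xs ! 0) (xs ! 2)))"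
      using apex by (simp add: apex_def)
    also have "card (N (xs ! 0) (xs ! 1) \<inter> N (xs ! 0) (xs ! 2)) \<le> card {v \<in> V. xs @ [v] \<in> T}"
      using xs by (intro card_mono) (auto simp: T_def)
    finally show "\<epsilon> * n \<le> real (card {v \<in> V. xs @ [v] \<in> T})"
      by simp
  qed (rule T, rule finite_lists_length[OF finV Q])
  moreover have "\<epsilon> * n * real (card T) \<le> real (card ?S)"
  proof (rule card_extend_lists[OF finV, of _ 6])
    fix ys assume "ys \<in> T"
    then obtain xs x4 where ys: "ys = xs @ [x4]" "xs \<in> Q" "{xs ! 0, xs ! 1, x4} \<in> E"
      "{xs ! 0, xs ! 2, x4} \<in> E" "x4 \<in> V"
      by (auto simp: T_def)
    moreover from ys(2) Q have "length xs = 4" "set xs \<subseteq> V"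
      by auto
    moreover from this(1) obtain x0 x1 x2 x3 where "xs = [x0, x1, x2, x3]"
      by (auto simp: numeral_eq_Suc length_Suc_conv)
    ultimately have xs: "xs = [x0, x1, x2, x3]" "set ys \<subseteq> V" "{x0, x1, x4} \<in> E" "{x0, x2, x4} \<in> E"
      by auto
    have "\<epsilon> * n \<le> real (card (N (xs ! 1) (xs ! k) \<inter> N (xs ! 1) (xs ! 3)))"
      using apex[OF ys(2)] by (simp add: apex_def)
    also have "N (xs ! 1) (xs ! k) \<inter> N (xs ! 1) (xs ! 3) \<subseteq> {v \<in> V. ys @ [v] \<in> ?S}"
      using k apex[OF ys(2)] xs ys(1)
      by (auto simp: pattern_def apex_def insert_commute)
    then have "card (N (xs ! 1) (xs ! k) \<inter> N (xs ! 1) (xs ! 3)) \<le> card {v \<in> V. ys @ [v] \<in> ?S}"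
      by (intro card_mono) auto
    finally show "\<epsilon> * n \<le> real (card {v \<in> V. ys @ [v] \<in> ?S})"
      by simp
  qed (auto intro: finite_lists_length[OF finV T])
  moreover have "\<epsilon> * n * (\<epsilon> * n * real (card Q)) \<le> \<epsilon> * n * real (card T)"
    using calculation(1) eps by (intro mult_left_mono) auto
  ultimately show ?thesis
    by (simp add: power2_eq_square mult.assoc)
qed

lemma many_pattern_homs:
  "\<exists>k\<in>{0, 2}. \<epsilon> ^ 10 / 8192 * n ^ 6 \<le> real (card {xs. set xs \<subseteq> V \<and> length xs = 6 \<and>
    (\<forall>e\<in>pattern k. (!) xs ` e \<in> E)})"
proof -
  have eq: "\<epsilon> ^ 10 / 8192 * n ^ 6 = (\<epsilon> * n)\<^sup>2 * (\<epsilon> ^ 8 / 8192 * n ^ 4)"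
    by (simp add: eval_nat_numeral)
  have "\<exists>k\<in>{0, 2}. \<exists>Q. Q \<subseteq> {xs. set xs \<subseteq> V \<and> length xs = 4} \<and> \<epsilon> ^ 8 / 8192 * n ^ 4 \<le> real (card Q) \<and>
      (\<forall>xs\<in>Q. apex (xs ! 0) (xs ! 1) (xs ! 2) \<and> apex (xs ! 1) (xs ! k) (xs ! 3))"
    using many_conflicts
  proof
    assume "\<epsilon> ^ 8 / 8192 * n ^ 4 \<le> real (card conflict_out)"
    then show ?thesis
      using conflict_subset(1)
      by (intro bexI[of _ 2] exI[of _ conflict_out]) (auto simp: conflict_out_def)
  next
    assume "\<epsilon> ^ 8 / 8192 * n ^ 4 \<le> real (card conflict_in)"
    then show ?thesis
      using conflict_subset(2)
      by (intro bexI[of _ 0] exI[of _ conflict_in]) (auto simp: conflict_in_def)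
  qed
  then obtain k Q where k: "k \<in> {0, 2}" and Q: "Q \<subseteq> {xs. set xs \<subseteq> V \<and> length xs = 4}"
    "\<epsilon> ^ 8 / 8192 * n ^ 4 \<le> real (card Q)"
    "\<And>xs. xs \<in> Q \<Longrightarrow> apex (xs ! 0) (xs ! 1) (xs ! 2) \<and> apex (xs ! 1) (xs ! k) (xs ! 3)"
    by blast
  have "(\<epsilon> * n)\<^sup>2 * (\<epsilon> ^ 8 / 8192 * n ^ 4) \<le> (\<epsilon> * n)\<^sup>2 * real (card Q)"
    using Q(2) by (intro mult_left_mono) auto
  also have "\<dots> \<le> real (card {xs. set xs \<subseteq> V \<and> length xs = 6 \<and> (\<forall>e\<in>pattern k. (!) xs ` e \<in> E)})"
    using card_pattern_homs[OF Q(1) _ Q(3)] k by auto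
  finally show ?thesis
    unfolding eq using k by blast
qed

end

section \<open>The upper bound\<close>

lemma pattern_contains_closed_walk:
  assumes "j \<in> {0, 2}"
  shows "\<exists>W. tight_walk (pattern j) (W @ take 2 W) \<and> length W = 3 * k + 11"
proof -
  have walk: ?thesis if "tight_walk (pattern j) (x # y # z # ws @ [x, y])" "length ws = 8" for x y z ws
  proof -
    let ?W = "concat (replicate k [x, y, z]) @ x # y # z # ws"
    have "take 2 ?W = [x, y]"
      by (cases k) auto
    moreover have "length ?W = 3 * k + 11"
      using that(2) by (simp add: length_concat sum_list_replicate)
    ultimately show ?thesis
      using tight_walk_replicate[OF that(1), of k] by (intro exI[of _ ?W]) simp
  qed
  show ?thesis
  proof (cases "j = 0")
    case True
    then show ?thesis
      \<comment> \<open>The eight listed vertices already form a closed walk; the leading 1, 0, 4 is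
        one extra lap around the edge \<open>{0, 1, 4}\<close>, bringing the length to 11.\<close>
      by (intro walk[of 1 0 4 "[1, 0, 4, 2, 0, 1, 5, 3]"]) (auto simp: pattern_def insert_commute)
  next
    case False
    then show ?thesis
      using assms
      \<comment> \<open>A closed walk of length 11 that uses all six edges of the pattern.\<close>
      by (intro walk[of 1 2 5 "[1, 3, 2, 1, 0, 4, 2, 0]"]) (auto simp: pattern_def insert_commute)
  qed
qed

lemma large_codegree_contains_tight_cycle:
  fixes \<epsilon> :: real
  assumes "0 < \<epsilon>"
  shows "\<exists>n0. \<forall>H :: 'a hypergraph. is_3graph H \<longrightarrow> n0 \<le> card (verts H) \<longrightarrow>
    (\<forall>u\<in>verts H. \<forall>v\<in>verts H. u \<noteq> v \<longrightarrow> (1 / 3 + \<epsilon>) * real (card (verts H)) \<le> real (codegree H u v)) \<longrightarrow>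
    contains_copy H (tight_cycle (3 * k + 11))"
proof -
  define dense where "dense j H \<longleftrightarrow> \<epsilon> ^ 10 / 8192 * real (card (verts H)) ^ 6 \<le>
    real (card {xs. set xs \<subseteq> verts H \<and> length xs = 6 \<and> (\<forall>e\<in>pattern j. (!) xs ` e \<in> edges H)})"
    for j and H :: "'a hypergraph"
  have cycle: "\<exists>N. \<forall>H. finite (verts H) \<longrightarrow> N \<le> card (verts H) \<longrightarrow> dense j H \<longrightarrow>
      contains_copy H (tight_cycle (3 * k + 11))" if j: "j \<in> {0, 2}" for j
  proof -
    obtain W where W: "tight_walk (pattern j) (W @ take 2 W)" "length W = 3 * k + 11"
      using pattern_contains_closed_walk[OF j] by blast
    have "e \<subseteq> {..<6} \<and> card e = 3" if "e \<in> pattern j" for e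
      using that j by (auto simp: pattern_def)
    then show ?thesis
      using dense_homs_contain_tight_cycle[of "\<epsilon> ^ 10 / 8192" "pattern j" 6 W] W assms
      by (simp add: dense_def)
  qed
  obtain N0 where N0: "\<forall>H. finite (verts H) \<longrightarrow> N0 \<le> card (verts H) \<longrightarrow> dense 0 H \<longrightarrow>
      contains_copy H (tight_cycle (3 * k + 11))"
    using cycle[of 0] by blast
  obtain N2 where N2: "\<forall>H. finite (verts H) \<longrightarrow> N2 \<le> card (verts H) \<longrightarrow> dense 2 H \<longrightarrow>
      contains_copy H (tight_cycle (3 * k + 11))"
    using cycle[of 2] by blast
  have "contains_copy H (tight_cycle (3 * k + 11))"
    if "is_3graph H" "max 15 (max N0 N2) \<le> card (verts H)"
      "\<forall>u\<in>verts H. \<forall>v\<in>verts H. u \<noteq> v \<longrightarrow> (1 / 3 + \<epsilon>) * real (card (verts H)) \<le> real (codegree H u v)"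
    for H :: "'a hypergraph"
  proof -
    interpret dense_3graph H \<epsilon>
      using that assms by unfold_locales auto
    have "dense 0 H \<or> dense 2 H"
      using many_pattern_homs by (simp add: dense_def)
    then show ?thesis
      using N0 N2 finV that(2) by (meson max.boundedE)
  qed
  then show ?thesis
    by blast
qed

lemma finite_nonempty_codegrees:
  assumes "is_3graph H" "2 \<le> card (verts H)"
  shows "finite {codegree H u v | u v. u \<in> verts H \<and> v \<in> verts H \<and> u \<noteq> v}"
    and "{codegree H u v | u v. u \<in> verts H \<and> v \<in> verts H \<and> u \<noteq> v} \<noteq> {}"
proof -
  have fin: "finite (verts H)"
    using assms(1) by (simp add: is_3graph_def)
  show "finite {codegree H u v | u v. u \<in> verts H \<and> v \<in> verts H \<and> u \<noteq> v}"
    by (rule finite_subset[of _ "(\<lambda>(u, v). codegree H u v) ` (verts H \<times> verts H)"]) (use fin in auto)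
  have "\<not> card (verts H) \<le> Suc 0"
    using assms(2) by simp
  then show "{codegree H u v | u v. u \<in> verts H \<and> v \<in> verts H \<and> u \<noteq> v} \<noteq> {}"
    using card_le_Suc0_iff_eq[OF fin] by auto
qed

text \<open>An extremal graph contains no copy of the cycle, so for large \<open>n\<close> some pair
  has codegree below the threshold of \<open>large_codegree_contains_tight_cycle\<close>.\<close>

lemma ex2_upper_bound:
  fixes \<epsilon> :: real
  assumes "0 < \<epsilon>"
  shows "\<exists>n0. \<forall>n\<ge>n0. real (ex2 n (tight_cycle (3 * k + 11))) \<le> (1 / 3 + \<epsilon>) * real n"
proof -
  let ?F = "tight_cycle (3 * k + 11)"
  obtain n0 where n0: "\<And>H :: nat hypergraph. is_3graph H \<Longrightarrow> n0 \<le> card (verts H) \<Longrightarrow>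
      \<forall>u\<in>verts H. \<forall>v\<in>verts H. u \<noteq> v \<longrightarrow>
        (1 / 3 + \<epsilon>) * real (card (verts H)) \<le> real (codegree H u v) \<Longrightarrow> contains_copy H ?F"
    using large_codegree_contains_tight_cycle[OF assms, where 'a = nat and k = k] by meson
  have "real (ex2 n ?F) \<le> (1 / 3 + \<epsilon>) * real n" if n: "max n0 2 \<le> n" for n
  proof -
    have "{0, 1 mod (3 * k + 11), 2 mod (3 * k + 11)} \<in> edges ?F"
      unfolding tight_cycle_def by force
    then have "edges ?F \<noteq> {}"
      by blast
    then have "ex2 n ?F \<in> free_codegrees n ?F"
      unfolding ex2_def using n by (intro Max_in finite_free_codegrees free_codegrees_nonempty) auto
    then obtain H :: "nat hypergraph" where H: "ex2 n ?F = min_codegree H" "is_3graph H"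
      "card (verts H) = n" "\<not> contains_copy H ?F"
      by (auto simp: free_codegrees_def)
    then obtain u v where uv: "u \<in> verts H" "v \<in> verts H" "u \<noteq> v"
      "real (codegree H u v) < (1 / 3 + \<epsilon>) * real n"
      using n0[of H] n by force
    have "min_codegree H \<le> codegree H u v"
      unfolding min_codegree_def using H n uv
      by (intro Min_le finite_nonempty_codegrees) auto
    then show ?thesis
      using H(1) uv(4) by simp
  qed
  then show ?thesis
    by blast
qed

section \<open>The lower bound\<close>

definition sum_one_3graph :: "nat \<Rightarrow> nat hypergraph" where
  "sum_one_3graph n = \<lparr>verts = {..<n}, edges = {e. e \<subseteq> {..<n} \<and> card e = 3 \<and> \<Sum>e mod 3 = 1}\<rparr>"

lemma card_residue_class:
  fixes n r :: nat
  assumes "r < 3"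
  shows "n div 3 \<le> card {w \<in> {..<n}. w mod 3 = r}"
proof -
  have "(\<lambda>q. 3 * q + r) ` {..<n div 3} \<subseteq> {w \<in> {..<n}. w mod 3 = r}"
    using assms by auto
  then have "card ((\<lambda>q. 3 * q + r) ` {..<n div 3}) \<le> card {w \<in> {..<n}. w mod 3 = r}"
    by (intro card_mono) auto
  then show ?thesis
    by (simp add: card_image inj_on_def)
qed

lemma codegree_sum_one_3graph:
  assumes "u < n" "v < n" "u \<noteq> v"
  shows "n div 3 - 2 \<le> codegree (sum_one_3graph n) u v"
proof -
  \<comment> \<open>The third vertex must be congruent to \<open>1 - (u + v)\<close>; the
    coefficient 2 stands for -1 modulo 3 and avoids subtraction. The loss of 2 in the bound comes
    from excluding \<open>u\<close> and \<open>v\<close>.\<close>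
  let ?R = "{w \<in> {..<n}. w mod 3 = (2 * (u + v) + 1) mod 3}"
  have "n div 3 - 2 \<le> card ?R - card {u, v}"
    using card_residue_class[of "(2 * (u + v) + 1) mod 3" n] assms by simp
  also have "\<dots> \<le> card (?R - {u, v})"
    by (intro diff_card_le_card_Diff) auto
  also have "\<dots> \<le> codegree (sum_one_3graph n) u v"
    unfolding codegree_def
  proof (intro card_mono subsetI)
    fix w assume w: "w \<in> ?R - {u, v}"
    then have "\<Sum>{u, v, w} = u + v + w"
      using assms by auto
    moreover have "(u + v + w) mod 3 = 1"
    proof -
      have "(u + v + w) mod 3 = (u + v + w mod 3) mod 3"
        by (simp only: mod_add_right_eq)
      also have "w mod 3 = (2 * (u + v) + 1) mod 3"
        using w by simp
      also have "(u + v + (2 * (u + v) + 1) mod 3) mod 3 = (1 + 3 * (u + v)) mod 3"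
        by (simp only: mod_add_right_eq) (simp add: algebra_simps)
      finally show ?thesis
        by (simp only: mod_mult_self2) simp
    qed
    ultimately show "w \<in> {w \<in> verts (sum_one_3graph n). {u, v, w} \<in> edges (sum_one_3graph n)}"
      using w assms by (auto simp: sum_one_3graph_def add.assoc)
  qed (simp add: sum_one_3graph_def)
  finally show ?thesis .
qed

lemma sum_one_3graph_free:
  assumes l: "l mod 3 = 2"
  shows "\<not> contains_copy (sum_one_3graph n) (tight_cycle l)"
proof
  assume "contains_copy (sum_one_3graph n) (tight_cycle l)"
  then obtain f where f: "\<forall>e\<in>edges (tight_cycle l). f ` e \<in> edges (sum_one_3graph n)"
    unfolding contains_copy_def by blast
  \<comment> \<open>The periodic extension of the embedding to all indices.\<close>
  define g where "g i = f (i mod l)" for i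
  have sum: "(g i + g (Suc i) + g (Suc (Suc i))) mod 3 = 1" for i
  proof -
    have "i mod l < l"
      using l by (intro mod_less_divisor) (cases l, auto)
    then have "{i mod l, (i mod l + 1) mod l, (i mod l + 2) mod l} \<in> edges (tight_cycle l)"
      unfolding tight_cycle_def by auto
    then have "{i mod l, Suc i mod l, Suc (Suc i) mod l} \<in> edges (tight_cycle l)"
      by (simp add: mod_Suc_eq mod_Suc_Suc_eq)
    then have "f ` {i mod l, Suc i mod l, Suc (Suc i) mod l} \<in> edges (sum_one_3graph n)"
      using f by blast
    then have e: "card {g i, g (Suc i), g (Suc (Suc i))} = 3"
      "\<Sum>{g i, g (Suc i), g (Suc (Suc i))} mod 3 = 1"
      by (simp_all add: sum_one_3graph_def g_def)
    from e(1) have "g i \<noteq> g (Suc i)" "g i \<noteq> g (Suc (Suc i))" "g (Suc i) \<noteq> g (Suc (Suc i))"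
      by (auto simp: card_insert_if split: if_splits)
    then have "\<Sum>{g i, g (Suc i), g (Suc (Suc i))} = g i + g (Suc i) + g (Suc (Suc i))"
      by simp
    then show ?thesis
      using e(2) by simp
  qed
  have period: "g (Suc (Suc (Suc i))) mod 3 = g i mod 3" for i
  proof -
    obtain p where p: "g i + g (Suc i) + g (Suc (Suc i)) = 3 * p + 1"
      using mult_div_mod_eq[of 3 "g i + g (Suc i) + g (Suc (Suc i))"] sum[of i] by metis
    obtain q where q: "g (Suc i) + g (Suc (Suc i)) + g (Suc (Suc (Suc i))) = 3 * q + 1"
      using mult_div_mod_eq[of 3 "g (Suc i) + g (Suc (Suc i)) + g (Suc (Suc (Suc i)))"]
        sum[of "Suc i"] by metis
    have "g (Suc (Suc (Suc i))) + 3 * p = g i + 3 * q"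
      using p q by linarith
    then have "(g (Suc (Suc (Suc i))) + 3 * p) mod 3 = (g i + 3 * q) mod 3"
      by (rule arg_cong)
    then show ?thesis
      by simp
  qed
  have "g (i + 3 * j) mod 3 = g i mod 3" for i j
  proof (induction j)
    case (Suc j)
    have "i + 3 * Suc j = Suc (Suc (Suc (i + 3 * j)))"
      by simp
    then show ?case
      using period[of "i + 3 * j"] Suc by (simp only:)
  qed simp
  \<comment> \<open>Since \<open>l\<close> is 2 modulo 3, rounding up to a multiple of 3 gives
    \<open>l + 1\<close>: steps of three, which preserve residues, reach the next vertex of the
    cycle.\<close>
  moreover have "g (i + 3 * (l div 3 + 1)) = g (Suc i)" for i
  proof -
    have "i + 3 * (l div 3 + 1) = Suc i + (3 * (l div 3) + l mod 3)"
      unfolding l by simp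
    then have "i + 3 * (l div 3 + 1) = Suc i + l"
      by (simp only: mult_div_mod_eq)
    then show ?thesis
      by (simp only: g_def mod_add_self2)
  qed
  ultimately have "g (Suc i) mod 3 = g i mod 3" for i
    by metis
  from this[of 0] this[of "Suc 0"]
  have "(g 0 + g (Suc 0) + g (Suc (Suc 0))) mod 3 = (g 0 + g 0 + g 0) mod 3"
    by (intro mod_add_cong) simp_all
  also have "g 0 + g 0 + g 0 = 3 * g 0"
    by simp
  finally show False
    using sum[of 0] by (simp only: mod_mult_self1_is_0)
qed

lemma ex2_lower_bound:
  assumes "2 \<le> n"
  shows "n div 3 - 2 \<le> ex2 n (tight_cycle (3 * k + 11))"
proof -
  let ?H = "sum_one_3graph n"
  have H: "is_3graph ?H" "card (verts ?H) = n"
    by (auto simp: is_3graph_def sum_one_3graph_def)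
  have "n div 3 - 2 \<le> min_codegree ?H"
    unfolding min_codegree_def
    using finite_nonempty_codegrees[of ?H] H assms codegree_sum_one_3graph
    by (subst Min_ge_iff) (auto simp: sum_one_3graph_def)
  also have "min_codegree ?H \<le> ex2 n (tight_cycle (3 * k + 11))"
    unfolding ex2_def using assms H sum_one_3graph_free[of "3 * k + 11" n]
    by (intro Max_ge finite_free_codegrees) (auto simp: free_codegrees_def)
  finally show ?thesis .
qed

section \<open>The density\<close>

lemma ex2_tight_cycle_LIMSEQ:
  "(\<lambda>n. real (ex2 n (tight_cycle (3 * k + 11))) / real n) \<longlonglongrightarrow> 1 / 3"
proof (rule LIMSEQ_I)
  fix r :: real assume r: "0 < r"
  let ?x = "\<lambda>n. real (ex2 n (tight_cycle (3 * k + 11)))"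
  obtain n0 where n0: "\<And>n. n0 \<le> n \<Longrightarrow> ?x n \<le> (1 / 3 + r / 2) * real n"
    using ex2_upper_bound[of "r / 2" k] r by auto
  have "norm (?x n / real n - 1 / 3) < r" if n: "max n0 (max 2 (nat \<lceil>4 / r\<rceil>)) \<le> n" for n
  proof -
    have "4 / r \<le> real n"
      using n by linarith
    then have rn: "4 \<le> r * real n"
      using r by (simp add: field_simps)
    \<comment> \<open>Rounding down costs at most 2 and the excluded vertices cost 6; the loss is
      thus less than 3 after division by 3, and \<open>rn\<close> absorbs it.\<close>
    have "n \<le> 3 * (n div 3 - 2) + 8"
      by linarith
    then have "real n / 3 - 3 < ?x n"
      using ex2_lower_bound[of n k] n by linarith
    then have "(1 / 3 - r) * real n < ?x n"
      using rn by (simp add: algebra_simps)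
    moreover have "?x n \<le> (1 / 3 + r / 2) * real n"
      using n0 n by simp
    moreover have "(1 / 3 + r / 2) * real n < (1 / 3 + r) * real n"
      using r n by (intro mult_strict_right_mono) auto
    ultimately have "(1 / 3 - r) * real n < ?x n" "?x n < (1 / 3 + r) * real n"
      by linarith+
    moreover have "0 < real n"
      using n by simp
    ultimately have "1 / 3 - r < ?x n / real n" "?x n / real n < 1 / 3 + r"
      by (simp_all only: pos_less_divide_eq pos_divide_less_eq)
    then show ?thesis
      by (simp add: abs_less_iff)
  qed
  then show "\<exists>N. \<forall>n\<ge>N. norm (?x n / real n - 1 / 3) < r"
    by blast
qed

text \<open>The three lengths are \<open>3 * k + 11\<close> for \<open>k\<close> = 0, 1, 2.
  Convergence is stated separately because \<open>lim\<close> has an unspecified value on divergent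
  sequences.\<close>

theorem theorem2:
  shows "\<forall>l \<in> {11, 14, 17}.
    convergent (\<lambda>n. real (ex2 n (tight_cycle l)) / real n) \<and>
    codegree_turan_density (tight_cycle l) = 1 / 3"
proof
  fix l :: nat assume "l \<in> {11, 14, 17}"
  then consider "l = 3 * 0 + 11" | "l = 3 * 1 + 11" | "l = 3 * 2 + 11"
    by auto
  then obtain k where "l = 3 * k + 11"
    by metis
  then have "(\<lambda>n. real (ex2 n (tight_cycle l)) / real n) \<longlonglongrightarrow> 1 / 3"
    using ex2_tight_cycle_LIMSEQ by simp
  then show "convergent (\<lambda>n. real (ex2 n (tight_cycle l)) / real n) \<and>
    codegree_turan_density (tight_cycle l) = 1 / 3"
    unfolding codegree_turan_density_def by (intro conjI convergentI limI)
qed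

end
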